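(* Fix $0<p<2$, $\eta>0$ and $n\ge1$. Then $\bar R_n^*(M_{n,p}(\eta))=\bar\rho_p(\eta)$.
   Context: Minimax-Bayes risk: $\bar R_n^*(M_{n,p}(\eta))=\inf_{\hat\mu}\sup_\pi\{\mathbb{E}_\pi\mathbb{E}_\mu[\frac1n\sum_{i=1}^n(\log\hat\mu_i-\log\mu_i)^2]:\ \mathbb{E}_\pi[\frac1n\sum_{i=1}^n\log^p\mu_i]\le\eta^p\}$, where $\pi$ ranges over distributions on $[1,\infty)^n$, given $\mu$ the data $X_1,\dots,X_n$ are independent with $X_i\sim\mathrm{Exp}(\mu_i)$ (mean $\mu_i$), and $\hat\mu$ ranges over estimators with values in $(0,\infty)^n$. Univariate minimax-Bayes risk: with $\mathcal F_p(\eta)$ the set of distributions $F$ on $[1,\infty)$ with $\int\log^p(\mu)\,dF(\mu)\le\eta^p$, a scalar $\mu\sim F$ and $X\mid\mu\sim\mathrm{Exp}(\mu)$, set $\bar\rho_p(\eta)=\inf_\delta\sup_{F\in\mathcal F_p(\eta)}\mathbb{E}_F\mathbb{E}_\mu(\log\delta(X)-\log\mu)^2$, infimum over measurable $\delta:[0,\infty)\to(0,\infty)$. *)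

theory Defs
  imports "HOL-Probability.Probability"
begin

text \<open>Law of the data X = (X_1,...,X_n) given mu: independent, X_i ~ Exp with MEAN mu_i
  (i.e. rate 1/mu_i).\<close>
definition exp_data :: "nat \<Rightarrow> (nat \<Rightarrow> real) \<Rightarrow> (nat \<Rightarrow> real) measure" where
  "exp_data n \<mu> = (\<Pi>\<^sub>M i\<in>{..<n}. density lborel (\<lambda>x. ennreal (exponential_density (1 / \<mu> i) x)))"

definition exp_law :: "real \<Rightarrow> real measure" where
  "exp_law \<mu> = density lborel (\<lambda>x. ennreal (exponential_density (1 / \<mu>) x))"

definition prior_class :: "nat \<Rightarrow> real \<Rightarrow> real \<Rightarrow> (nat \<Rightarrow> real) measure set" where
  "prior_class n p \<eta> = {\<pi>. prob_space \<pi> \<and>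
      sets \<pi> = sets (\<Pi>\<^sub>M i\<in>{..<n}. (borel :: real measure)) \<and>
      (AE \<mu> in \<pi>. \<forall>i<n. 1 \<le> \<mu> i) \<and>
      (\<integral>\<^sup>+ \<mu>. ennreal ((1 / real n) * (\<Sum>i<n. ln (\<mu> i) powr p)) \<partial>\<pi>) \<le> ennreal (\<eta> powr p)}"

definition estimators :: "nat \<Rightarrow> ((nat \<Rightarrow> real) \<Rightarrow> (nat \<Rightarrow> real)) set" where
  "estimators n = {\<delta>. (\<forall>i<n. (\<lambda>x. \<delta> x i) \<in> borel_measurable (\<Pi>\<^sub>M i\<in>{..<n}. (borel :: real measure)))
      \<and> (\<forall>x. \<forall>i<n. 0 < \<delta> x i)}"

definition bayes_risk :: "nat \<Rightarrow> ((nat \<Rightarrow> real) \<Rightarrow> (nat \<Rightarrow> real)) \<Rightarrow> (nat \<Rightarrow> real) measure \<Rightarrow> ennreal" where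
  "bayes_risk n \<delta> \<pi> = (\<integral>\<^sup>+ \<mu>. (\<integral>\<^sup>+ x. ennreal ((1 / real n) * (\<Sum>i<n. (ln (\<delta> x i) - ln (\<mu> i))\<^sup>2)) \<partial>exp_data n \<mu>) \<partial>\<pi>)"

definition minimax_bayes_risk :: "nat \<Rightarrow> real \<Rightarrow> real \<Rightarrow> ennreal" where
  "minimax_bayes_risk n p \<eta> = (INF \<delta>\<in>estimators n. SUP \<pi>\<in>prior_class n p \<eta>. bayes_risk n \<delta> \<pi>)"

definition prior_class1 :: "real \<Rightarrow> real \<Rightarrow> real measure set" where
  "prior_class1 p \<eta> = {F. prob_space F \<and> sets F = sets (borel :: real measure) \<and>
      (AE \<mu> in F. 1 \<le> \<mu>) \<and>
      (\<integral>\<^sup>+ \<mu>. ennreal (ln \<mu> powr p) \<partial>F) \<le> ennreal (\<eta> powr p)}"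

definition estimators1 :: "(real \<Rightarrow> real) set" where
  "estimators1 = {\<delta>. \<delta> \<in> borel_measurable borel \<and> (\<forall>x. 0 < \<delta> x)}"

definition bayes_risk1 :: "(real \<Rightarrow> real) \<Rightarrow> real measure \<Rightarrow> ennreal" where
  "bayes_risk1 \<delta> F = (\<integral>\<^sup>+ \<mu>. (\<integral>\<^sup>+ x. ennreal ((ln (\<delta> x) - ln \<mu>)\<^sup>2) \<partial>exp_law \<mu>) \<partial>F)"

definition rho_bar :: "real \<Rightarrow> real \<Rightarrow> ennreal" where
  "rho_bar p \<eta> = (INF \<delta>\<in>estimators1. SUP F\<in>prior_class1 p \<eta>. bayes_risk1 \<delta> F)"

end

theory Submission
  imports Defs
begin

text \<open>
  Write \<open>t = ln \<delta>\<close>, let \<open>B(t, F)\<close> be the univariate Bayes risk and let \<open>V\<close> be the supremum over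
  the univariate priors \<open>F\<close> of \<open>b(F) = inf\<^sub>t B(t, F)\<close>. A coordinatewise rule has, under any prior, the
  univariate risk under the average of the marginals, so the \<open>n\<close>-variate value is at most the univariate
  one. Under a product prior, fixing the means and the data of the other coordinates leaves a univariate
  rule, so the \<open>n\<close>-variate value is at least \<open>V\<close>.

  It remains to see that one rule has risk at most \<open>V\<close> for every prior. As \<open>B\<close> is quadratic in \<open>t\<close>,
  the parallelogram identity makes any two near-optimal rules for \<open>F\<close> close in \<open>L\<^sup>2\<close> of the law of the
  data, and that law dominates a multiple of Exp(1) which the moment constraint bounds below uniformly in
  \<open>F\<close>. Choose \<open>F\<^sub>k\<close> with \<open>b(F\<^sub>k)\<close> tending fast to \<open>V\<close> and near-optimal rules \<open>t\<^sub>k\<close>. For any prior \<open>G\<close>, a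
  near-optimal rule for the mixture \<open>(1 - l) F\<^sub>k + l G\<close> is near-optimal for \<open>F\<^sub>k\<close>, hence close to \<open>t\<^sub>k\<close>,
  and its risk at \<open>G\<close> hardly exceeds \<open>V\<close>. With \<open>G = F\<^bsub>k+1\<^esub>\<close> this makes the \<open>t\<^sub>k\<close> converge almost
  everywhere, and for general \<open>G\<close> and \<open>l\<close> tending to 0 Fatou's lemma bounds the risk of the limit at \<open>G\<close>.
\<close>

subsection \<open>The univariate problem in terms of \<open>ln \<delta>\<close>\<close>

text \<open>Here \<open>m\<close> is the mean. Keeping the law as a density against
  \<open>lborel\<close>, jointly measurable in \<open>m\<close> and \<open>x\<close>, makes Tonelli
  and Fatou available for the iterated integrals below.\<close>

definition exp_dens :: "real \<Rightarrow> real \<Rightarrow> ennreal" where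
  "exp_dens m x = ennreal (exponential_density (1 / m) x)"

lemma measurable_exp_dens [measurable (raw)]:
  assumes [measurable]: "f \<in> borel_measurable M" "g \<in> borel_measurable M"
  shows "(\<lambda>w. exp_dens (f w) (g w)) \<in> borel_measurable M"
  unfolding exp_dens_def exponential_density_def by measurable

definition log_risk :: "(real \<Rightarrow> real) \<Rightarrow> real measure \<Rightarrow> ennreal" where
  "log_risk t F = (\<integral>\<^sup>+m. \<integral>\<^sup>+x. exp_dens m x * ennreal ((t x - ln m)\<^sup>2) \<partial>lborel \<partial>F)"

text \<open>The squared L2 distance of \<open>s\<close> and \<open>t\<close> under the marginal law
  of the data when the mean has prior \<open>F\<close>.\<close>

definition log_dist :: "(real \<Rightarrow> real) \<Rightarrow> (real \<Rightarrow> real) \<Rightarrow> real measure \<Rightarrow> ennreal" where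
  "log_dist s t F = (\<integral>\<^sup>+m. \<integral>\<^sup>+x. exp_dens m x * ennreal ((s x - t x)\<^sup>2) \<partial>lborel \<partial>F)"

definition bayes_value :: "real measure \<Rightarrow> ennreal" where
  "bayes_value F = (INF t\<in>borel_measurable borel. log_risk t F)"

lemma bayes_value_le: "t \<in> borel_measurable borel \<Longrightarrow> bayes_value F \<le> log_risk t F"
  unfolding bayes_value_def by (rule INF_lower)

lemma bayes_risk1_eq_log_risk:
  assumes [measurable]: "\<delta> \<in> borel_measurable borel"
  shows "bayes_risk1 \<delta> F = log_risk (\<lambda>x. ln (\<delta> x)) F"
  unfolding bayes_risk1_def log_risk_def exp_law_def exp_dens_def
  by (subst nn_integral_density) simp_all

text \<open>\<open>exp\<close> and \<open>ln\<close> translate between arbitrary real-valued rules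
  and positive estimators, so the positivity constraint disappears and rules may be averaged
  freely.\<close>

lemma rho_bar_eq_log_risk:
  "rho_bar p \<eta> = (INF t\<in>borel_measurable borel. SUP F\<in>prior_class1 p \<eta>. log_risk t F)"
proof (rule antisym)
  show "rho_bar p \<eta> \<le> (INF t\<in>borel_measurable borel. SUP F\<in>prior_class1 p \<eta>. log_risk t F)"
  proof (rule INF_greatest)
    fix t :: "real \<Rightarrow> real" assume t [measurable]: "t \<in> borel_measurable borel"
    have "(\<lambda>x. exp (t x)) \<in> estimators1"
      unfolding estimators1_def by simp
    then have "rho_bar p \<eta> \<le> (SUP F\<in>prior_class1 p \<eta>. bayes_risk1 (\<lambda>x. exp (t x)) F)"
      unfolding rho_bar_def by (rule INF_lower)
    then show "rho_bar p \<eta> \<le> (SUP F\<in>prior_class1 p \<eta>. log_risk t F)"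
      by (simp add: bayes_risk1_eq_log_risk)
  qed
  show "(INF t\<in>borel_measurable borel. SUP F\<in>prior_class1 p \<eta>. log_risk t F) \<le> rho_bar p \<eta>"
    unfolding rho_bar_def
  proof (rule INF_greatest)
    fix \<delta> assume "\<delta> \<in> estimators1"
    then have [measurable]: "\<delta> \<in> borel_measurable borel"
      by (simp add: estimators1_def)
    show "(INF t\<in>borel_measurable borel. SUP F\<in>prior_class1 p \<eta>. log_risk t F)
        \<le> (SUP F\<in>prior_class1 p \<eta>. bayes_risk1 \<delta> F)"
      by (rule INF_lower2[of "\<lambda>x. ln (\<delta> x)"]) (simp_all add: bayes_risk1_eq_log_risk)
  qed
qed

text \<open>Integrate the pointwise parallelogram identity for \<open>s x - ln m\<close> and
  \<open>t x - ln m\<close>. Only sums appear, since the risks may be infinite.\<close>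

lemma log_risk_parallelogram:
  assumes [measurable_cong]: "sets F = sets borel"
    and [measurable]: "s \<in> borel_measurable borel" "t \<in> borel_measurable borel"
  shows "4 * log_risk (\<lambda>x. (s x + t x) / 2) F + log_dist s t F = 2 * log_risk s F + 2 * log_risk t F"
proof -
  have *: "4 * (exp_dens m x * ennreal (((s x + t x) / 2 - ln m)\<^sup>2)) + exp_dens m x * ennreal ((s x - t x)\<^sup>2)
     = 2 * (exp_dens m x * ennreal ((s x - ln m)\<^sup>2)) + 2 * (exp_dens m x * ennreal ((t x - ln m)\<^sup>2))"
    for m x
  proof -
    have "4 * ((s x + t x) / 2 - ln m)\<^sup>2 + (s x - t x)\<^sup>2 = 2 * (s x - ln m)\<^sup>2 + 2 * (t x - ln m)\<^sup>2"
      by (simp add: power2_eq_square field_simps)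
    then have "ennreal (4 * ((s x + t x) / 2 - ln m)\<^sup>2 + (s x - t x)\<^sup>2)
        = ennreal (2 * (s x - ln m)\<^sup>2 + 2 * (t x - ln m)\<^sup>2)"
      by simp
    then have "4 * ennreal (((s x + t x) / 2 - ln m)\<^sup>2) + ennreal ((s x - t x)\<^sup>2)
        = 2 * ennreal ((s x - ln m)\<^sup>2) + 2 * ennreal ((t x - ln m)\<^sup>2)"
      by (simp add: ennreal_plus ennreal_mult del: ennreal_plus_if flip: ennreal_numeral)
    then have "exp_dens m x * (4 * ennreal (((s x + t x) / 2 - ln m)\<^sup>2) + ennreal ((s x - t x)\<^sup>2))
        = exp_dens m x * (2 * ennreal ((s x - ln m)\<^sup>2) + 2 * ennreal ((t x - ln m)\<^sup>2))"
      by (rule arg_cong)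
    then show ?thesis
      by (simp add: distrib_left mult.left_commute)
  qed
  show ?thesis
    unfolding log_risk_def log_dist_def
    by (simp add: nn_integral_add[symmetric] nn_integral_cmult[symmetric] *)
qed

section \<open>Uniform comparison of the data laws with Exp(1)\<close>

text \<open>For \<open>m \<ge> 1\<close> the exponential with mean \<open>m\<close> decays more
  slowly than Exp(1), so only the prefactor \<open>1 / m\<close> is lost.\<close>

lemma exp_dens_ge_scaled:
  assumes "1 \<le> m"
  shows "ennreal (1 / m) * exp_dens 1 x \<le> exp_dens m x"
proof (cases "x < 0")
  case False
  have "x / m \<le> x"
    using False assms by (simp add: divide_le_eq mult_le_cancel_left1)
  then have "1 / m * exp (- x) \<le> 1 / m * exp (- (x / m))"
    using assms by (intro mult_left_mono) auto
  then show ?thesis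
    using False assms
    by (simp add: exp_dens_def exponential_density_def ennreal_mult[symmetric] ennreal_leI)
qed (simp add: exp_dens_def exponential_density_def)

text \<open>Integrated against a prior, this bounds the mean of \<open>1 / m\<close> below in terms of the \<open>p\<close>-th moment of \<open>ln m\<close>.\<close>

lemma reciprocal_lower_bound:
  fixes m M a p :: real
  assumes "1 \<le> m" "0 < p" "0 < M" "M powr p = a"
  shows "exp (- M) \<le> 1 / m + exp (- M) / a * ln m powr p"
proof (cases "ln m \<le> M")
  case True
  have "1 / m = exp (- ln m)"
    using assms by (simp add: exp_minus inverse_eq_divide)
  moreover have "exp (- M) \<le> exp (- ln m)"
    using True by simp
  moreover have "0 \<le> exp (- M) / a * ln m powr p"
    using assms by (intro mult_nonneg_nonneg) auto
  ultimately show ?thesis by linarith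
next
  case False
  have a: "0 < a" using assms by auto
  have "a \<le> ln m powr p"
    using False assms by (metis less_eq_real_def linorder_not_less powr_mono2)
  then have "exp (- M) / a * a \<le> exp (- M) / a * ln m powr p"
    using a by (intro mult_left_mono) auto
  then show ?thesis
    using a assms by (simp add: add_increasing)
qed

text \<open>The point is uniformity: the constant depends on \<open>p\<close> and
  \<open>\<eta>\<close> but not on \<open>F\<close>.\<close>

lemma prior_reciprocal_moment_ge:
  assumes "0 < p" "0 < \<eta>" and F: "F \<in> prior_class1 p \<eta>"
  shows "ennreal (exp (- (\<eta> * 2 powr (1 / p))) / 2) \<le> (\<integral>\<^sup>+m. ennreal (1 / m) \<partial>F)"
proof -
  \<comment> \<open>The level solves \<open>M powr p = 2 * \<eta> powr p\<close>, so that the moment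
    term costs at most half of \<open>exp (- M)\<close>.\<close>
  define M where "M = \<eta> * 2 powr (1 / p)"
  define a where "a = 2 * \<eta> powr p"
  have Ma: "M powr p = a" "0 < M" "0 < a"
    using assms by (simp_all add: M_def a_def powr_mult powr_powr)
  interpret F: prob_space F
    using F by (simp add: prior_class1_def)
  have [measurable_cong]: "sets F = sets borel"
    and ae: "AE m in F. 1 \<le> m"
    and mom: "(\<integral>\<^sup>+m. ennreal (ln m powr p) \<partial>F) \<le> ennreal (\<eta> powr p)"
    using F by (simp_all add: prior_class1_def)
  have "ennreal (exp (- M)) = (\<integral>\<^sup>+m. ennreal (exp (- M)) \<partial>F)"
    by (simp add: F.emeasure_space_1)
  also have "\<dots> \<le> (\<integral>\<^sup>+m. ennreal (1 / m) + ennreal (exp (- M) / a) * ennreal (ln m powr p) \<partial>F)"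
  proof (rule nn_integral_mono_AE, use ae in eventually_elim)
    case (elim m)
    then show ?case
      using reciprocal_lower_bound[OF elim assms(1) Ma(2,1)] Ma(3)
      by (simp add: ennreal_mult[symmetric] ennreal_plus[symmetric] ennreal_leI del: ennreal_plus)
  qed
  also have "\<dots> = (\<integral>\<^sup>+m. ennreal (1 / m) \<partial>F)
      + ennreal (exp (- M) / a) * (\<integral>\<^sup>+m. ennreal (ln m powr p) \<partial>F)"
    by (simp add: nn_integral_add nn_integral_cmult)
  also have "\<dots> \<le> (\<integral>\<^sup>+m. ennreal (1 / m) \<partial>F) + ennreal (exp (- M) / a) * ennreal (\<eta> powr p)"
    using mom by (intro add_left_mono mult_left_mono) auto
  also have "ennreal (exp (- M) / a) * ennreal (\<eta> powr p) = ennreal (exp (- M) / 2)"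
    using assms Ma(3) by (simp add: ennreal_mult[symmetric] a_def)
  finally have "ennreal (exp (- M)) - ennreal (exp (- M) / 2) \<le> (\<integral>\<^sup>+m. ennreal (1 / m) \<partial>F)"
    by (simp add: ennreal_minus_le_iff add.commute)
  then show ?thesis
    by (simp add: M_def ennreal_minus)
qed

text \<open>Minorizing each density by \<open>1 / m\<close> times Exp(1) makes the double integral
  factor into the mean of \<open>1 / m\<close> and a distance that no longer involves
  \<open>F\<close>.\<close>

lemma log_dist_ge_exp1:
  assumes "0 < p" "0 < \<eta>" and F: "F \<in> prior_class1 p \<eta>"
    and [measurable]: "s \<in> borel_measurable borel" "t \<in> borel_measurable borel"
  shows "ennreal (exp (- (\<eta> * 2 powr (1 / p))) / 2) * (\<integral>\<^sup>+x. exp_dens 1 x * ennreal ((s x - t x)\<^sup>2) \<partial>lborel)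
    \<le> log_dist s t F"
proof -
  have [measurable_cong]: "sets F = sets borel" and ae: "AE m in F. 1 \<le> m"
    using F by (simp_all add: prior_class1_def)
  let ?N = "\<integral>\<^sup>+x. exp_dens 1 x * ennreal ((s x - t x)\<^sup>2) \<partial>lborel"
  have "ennreal (exp (- (\<eta> * 2 powr (1 / p))) / 2) * ?N \<le> (\<integral>\<^sup>+m. ennreal (1 / m) \<partial>F) * ?N"
    by (intro mult_right_mono prior_reciprocal_moment_ge assms) auto
  also have "\<dots> = (\<integral>\<^sup>+m. \<integral>\<^sup>+x. ennreal (1 / m) * exp_dens 1 x * ennreal ((s x - t x)\<^sup>2) \<partial>lborel \<partial>F)"
    by (simp add: nn_integral_multc nn_integral_cmult mult.assoc)
  also have "\<dots> \<le> log_dist s t F"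
    unfolding log_dist_def
    by (rule nn_integral_mono_AE, use ae in eventually_elim)
       (intro nn_integral_mono mult_right_mono exp_dens_ge_scaled, auto)
  finally show ?thesis .
qed

section \<open>Mixtures of priors\<close>

text \<open>Used with Bernoulli weights for convex combinations of two priors, and with uniform
  weights for the average of the marginals of a multivariate prior.\<close>

lemma nn_integral_pmf_mixture:
  fixes q :: "'i pmf" and M :: "'i \<Rightarrow> real measure"
  assumes "\<And>i. prob_space (M i)" "\<And>i. sets (M i) = sets borel"
  shows "prob_space (measure_pmf q \<bind> M)" "sets (measure_pmf q \<bind> M) = sets borel"
    "\<And>f. f \<in> borel_measurable borel \<Longrightarrow>
      (\<integral>\<^sup>+m. f m \<partial>(measure_pmf q \<bind> M)) = (\<integral>\<^sup>+i. \<integral>\<^sup>+m. f m \<partial>M i \<partial>measure_pmf q)"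
    "\<And>P. Measurable.pred borel P \<Longrightarrow>
      (AE m in measure_pmf q \<bind> M. P m) \<longleftrightarrow> (AE i in measure_pmf q. AE m in M i. P m)"
proof -
  have M: "M \<in> measure_pmf q \<rightarrow>\<^sub>M subprob_algebra borel"
    using assms by (auto simp: space_subprob_algebra prob_space_imp_subprob_space)
  show "prob_space (measure_pmf q \<bind> M)"
    by (rule measure_pmf.prob_space_bind[OF _ M]) (simp add: assms)
  show "sets (measure_pmf q \<bind> M) = sets borel"
    by (rule sets_bind) (simp_all add: assms)
  show "(\<integral>\<^sup>+m. f m \<partial>(measure_pmf q \<bind> M)) = (\<integral>\<^sup>+i. \<integral>\<^sup>+m. f m \<partial>M i \<partial>measure_pmf q)"
    if "f \<in> borel_measurable borel" for f
    by (rule nn_integral_bind[OF that M])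
  show "(AE m in measure_pmf q \<bind> M. P m) \<longleftrightarrow> (AE i in measure_pmf q. AE m in M i. P m)"
    if "Measurable.pred borel P" for P
    by (rule AE_bind[OF M that])
qed

text \<open>The constraints are preserved by mixing and the risk of a fixed rule is an integral
  against the prior, so the class is convex and the risk affine on it.\<close>

lemma prior_class1_mixture:
  assumes F: "F \<in> prior_class1 p \<eta>" and G: "G \<in> prior_class1 p \<eta>" and l: "0 \<le> l" "l \<le> 1"
  obtains H where "H \<in> prior_class1 p \<eta>"
    "\<And>t. t \<in> borel_measurable borel \<Longrightarrow>
      log_risk t H = ennreal l * log_risk t G + ennreal (1 - l) * log_risk t F"
proof
  define M where "M b = (if b then G else F)" for b
  have FG: "prob_space F" "prob_space G" "sets F = sets borel" "sets G = sets borel"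
    using F G by (simp_all add: prior_class1_def)
  have M: "\<And>b. prob_space (M b)" "\<And>b. sets (M b) = sets borel"
    using FG by (simp_all add: M_def)
  let ?H = "measure_pmf (bernoulli_pmf l) \<bind> M"
  note H = nn_integral_pmf_mixture[where q = "bernoulli_pmf l" and M = M, OF M]
  have int: "(\<integral>\<^sup>+m. f m \<partial>?H) = ennreal l * (\<integral>\<^sup>+m. f m \<partial>G) + ennreal (1 - l) * (\<integral>\<^sup>+m. f m \<partial>F)"
    if "f \<in> borel_measurable borel" for f
    using l by (simp add: H(3)[OF that] M_def mult.commute)
  have "(\<integral>\<^sup>+m. ennreal (ln m powr p) \<partial>?H)
      \<le> ennreal l * ennreal (\<eta> powr p) + ennreal (1 - l) * ennreal (\<eta> powr p)"
    using F G by (subst int) (auto simp: prior_class1_def intro!: add_mono mult_left_mono)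
  also have "\<dots> = ennreal (\<eta> powr p)"
    using l by (simp add: distrib_right[symmetric] ennreal_plus[symmetric] del: ennreal_plus)
  finally have "(\<integral>\<^sup>+m. ennreal (ln m powr p) \<partial>?H) \<le> ennreal (\<eta> powr p)" .
  moreover have "AE b in measure_pmf (bernoulli_pmf l). AE m in M b. 1 \<le> m"
    using F G unfolding M_def prior_class1_def by (auto split: if_split)
  ultimately show "?H \<in> prior_class1 p \<eta>"
    using H(1,2) by (simp add: prior_class1_def H(4))
  show "log_risk t ?H = ennreal l * log_risk t G + ennreal (1 - l) * log_risk t F"
    if [measurable]: "t \<in> borel_measurable borel" for t
    unfolding log_risk_def by (rule int) measurable
qed

subsection \<open>The univariate minimax theorem\<close>

text \<open>The midpoint of \<open>s\<close> and \<open>t\<close> has risk at least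
  \<open>V - \<epsilon>\<close>, so the parallelogram identity leaves at most
  \<open>2 * (V + e) + 2 * (V + \<epsilon>) - 4 * (V - \<epsilon>)\<close> for the distance.\<close>

lemma near_bayes_close:
  assumes F: "sets F = sets borel"
    and st: "s \<in> borel_measurable borel" "t \<in> borel_measurable borel"
    and nonneg: "0 \<le> V" "0 \<le> \<epsilon>" "0 \<le> e"
    and V: "ennreal V \<le> bayes_value F + ennreal \<epsilon>"
    and t: "log_risk t F \<le> ennreal (V + \<epsilon>)"
    and s: "log_risk s F \<le> ennreal (V + e)"
  shows "log_dist s t F \<le> ennreal (6 * \<epsilon> + 2 * e)"
proof -
  let ?r = "log_risk (\<lambda>x. (s x + t x) / 2) F"
  have mid: "bayes_value F \<le> ?r"
    using st by (intro bayes_value_le) simp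
  have "2 * log_risk s F + 2 * log_risk t F \<le> 2 * ennreal (V + e) + 2 * ennreal (V + \<epsilon>)"
    by (intro add_mono mult_left_mono s t) auto
  also have "\<dots> = ennreal (4 * V + 2 * e + 2 * \<epsilon>)"
    using nonneg by (simp add: ennreal_mult[symmetric] ennreal_plus[symmetric] del: ennreal_plus flip: ennreal_numeral)
  finally have sum: "4 * ?r + log_dist s t F \<le> ennreal (4 * V + 2 * e + 2 * \<epsilon>)"
    by (simp add: log_risk_parallelogram[OF F st])
  \<comment> \<open>Finiteness comes first; only then can the inequality be moved to the reals and
    solved for the distance.\<close>
  have fin: "4 * ?r < \<top>" "log_dist s t F < \<top>"
    using order.strict_trans1[OF sum ennreal_less_top] by (simp_all add: ennreal_add_eq_top less_top)
  then have "?r < \<top>"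
    by (auto simp: ennreal_mult_less_top)
  then obtain r d where rd: "?r = ennreal r" "0 \<le> r" "log_dist s t F = ennreal d" "0 \<le> d"
    using fin(2) by (metis ennreal_cases less_irrefl infinity_ennreal_def)
  have "ennreal V \<le> ennreal (r + \<epsilon>)"
    using order_trans[OF V add_right_mono[OF mid]] rd nonneg by simp
  then have "V \<le> r + \<epsilon>"
    using rd nonneg by (simp del: ennreal_plus)
  moreover have "ennreal (4 * r + d) \<le> ennreal (4 * V + 2 * e + 2 * \<epsilon>)"
    using sum rd by (simp add: ennreal_mult)
  then have "4 * r + d \<le> 4 * V + 2 * e + 2 * \<epsilon>"
    using nonneg by (simp del: ennreal_plus)
  ultimately show ?thesis
    using rd by (simp add: ennreal_leI)
qed

text \<open>Take \<open>s\<close> with risk below \<open>V + \<epsilon>\<close> at the mixture.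
  Since its risk at \<open>F\<close> is at least \<open>V - \<epsilon>\<close>, the risk at
  \<open>G\<close> cannot be much above \<open>V\<close>, and symmetrically with
  \<open>V - e\<close> at \<open>G\<close>. The defect \<open>e\<close> of \<open>G\<close> may be
  large: it enters the bound at \<open>F\<close> only through \<open>l * e\<close>.\<close>

lemma mixture_near_minimax:
  assumes F: "F \<in> prior_class1 p \<eta>" "G \<in> prior_class1 p \<eta>"
    and le: "\<And>H. H \<in> prior_class1 p \<eta> \<Longrightarrow> bayes_value H \<le> ennreal V"
    and nonneg: "0 \<le> V" "0 < \<epsilon>" "0 \<le> e" "0 < l" "l < 1"
    and VF: "ennreal V \<le> bayes_value F + ennreal \<epsilon>"
    and VG: "ennreal V \<le> bayes_value G + ennreal e"
  obtains s where "s \<in> borel_measurable borel"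
    "log_risk s G \<le> ennreal (V + 2 * \<epsilon> / l)"
    "log_risk s F \<le> ennreal (V + (\<epsilon> + l * e) / (1 - l))"
proof -
  obtain H where H: "H \<in> prior_class1 p \<eta>"
    and risk: "\<And>t. t \<in> borel_measurable borel \<Longrightarrow>
      log_risk t H = ennreal l * log_risk t G + ennreal (1 - l) * log_risk t F"
    using nonneg by (elim prior_class1_mixture[OF F(1) F(2), of l, rotated 2]) auto
  have "bayes_value H < ennreal (V + \<epsilon>)"
    using le[OF H] nonneg by (simp add: ennreal_lessI order.strict_trans1)
  then obtain s where s: "s \<in> borel_measurable borel" "log_risk s H < ennreal (V + \<epsilon>)"
    unfolding bayes_value_def by (auto simp: INF_less_iff)
  have sum: "ennreal l * log_risk s G + ennreal (1 - l) * log_risk s F \<le> ennreal (V + \<epsilon>)"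
    using s by (simp add: risk)
  then have "ennreal l * log_risk s G < \<top>" "ennreal (1 - l) * log_risk s F < \<top>"
    using order.strict_trans1[OF sum ennreal_less_top] by (simp_all add: ennreal_add_eq_top less_top)
  then have "log_risk s G < \<top>" "log_risk s F < \<top>"
    using nonneg by (auto simp: ennreal_mult_less_top)
  then obtain a b where ab: "log_risk s G = ennreal a" "0 \<le> a" "log_risk s F = ennreal b" "0 \<le> b"
    by (metis ennreal_cases less_irrefl infinity_ennreal_def)
  have "ennreal V \<le> ennreal (a + e)" "ennreal V \<le> ennreal (b + \<epsilon>)"
    using order_trans[OF VG add_right_mono[OF bayes_value_le[OF s(1)]]]
      order_trans[OF VF add_right_mono[OF bayes_value_le[OF s(1)]]] ab nonneg by simp_all
  then have V: "V \<le> a + e" "V \<le> b + \<epsilon>"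
    using ab nonneg by (simp_all del: ennreal_plus)
  have "ennreal (l * a + (1 - l) * b) \<le> ennreal (V + \<epsilon>)"
    using sum ab nonneg by (simp add: ennreal_mult)
  then have le: "l * a + (1 - l) * b \<le> V + \<epsilon>"
    using nonneg by (simp del: ennreal_plus)
  have "l * a \<le> l * V + 2 * \<epsilon>"
  proof -
    have "(1 - l) * V \<le> (1 - l) * (b + \<epsilon>)" "0 < l * \<epsilon>"
      using V nonneg by (auto intro: mult_left_mono)
    then show ?thesis
      using le unfolding left_diff_distrib distrib_left mult_1 by linarith
  qed
  then have "a \<le> V + 2 * \<epsilon> / l"
    using nonneg by (simp add: field_simps)
  moreover have "(1 - l) * b \<le> (1 - l) * V + (\<epsilon> + l * e)"
    using le mult_left_mono[OF V(1), of l] nonneg by (simp add: algebra_simps)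
  then have "b \<le> V + (\<epsilon> + l * e) / (1 - l)"
    using nonneg by (simp add: field_simps)
  ultimately show thesis
    using that[OF s(1)] ab by (simp add: ennreal_leI)
qed

section \<open>Almost everywhere limits and lower semicontinuity of the risk\<close>

text \<open>By monotone convergence the weighted series has finite integral, hence is finite almost
  everywhere. The weight is positive exactly on the half-line \<open>0 \<le> x\<close>, and only
  there can it be cancelled.\<close>

lemma AE_summable_exp1:
  fixes g :: "nat \<Rightarrow> real \<Rightarrow> real"
  assumes [measurable]: "\<And>k. g k \<in> borel_measurable borel"
    and nonneg: "\<And>k x. 0 \<le> g k x" "\<And>k. 0 \<le> a k"
    and le: "\<And>k. (\<integral>\<^sup>+x. exp_dens 1 x * ennreal (g k x) \<partial>lborel) \<le> ennreal (a k)"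
    and a: "summable a"
  shows "AE x in lborel. 0 \<le> x \<longrightarrow> summable (\<lambda>k. g k x)"
proof -
  have "(\<integral>\<^sup>+x. exp_dens 1 x * (\<Sum>k. ennreal (g k x)) \<partial>lborel)
      = (\<integral>\<^sup>+x. (\<Sum>k. exp_dens 1 x * ennreal (g k x)) \<partial>lborel)"
    by simp
  also have "\<dots> = (\<Sum>k. \<integral>\<^sup>+x. exp_dens 1 x * ennreal (g k x) \<partial>lborel)"
    by (rule nn_integral_suminf) measurable
  also have "\<dots> \<le> (\<Sum>k. ennreal (a k))"
    by (intro suminf_le le) auto
  also have "\<dots> = ennreal (suminf a)"
    using a nonneg(2) by (simp add: suminf_ennreal2)
  finally have "(\<integral>\<^sup>+x. exp_dens 1 x * (\<Sum>k. ennreal (g k x)) \<partial>lborel) \<noteq> \<infinity>"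
    by (metis ennreal_less_top infinity_ennreal_def leD)
  then have "AE x in lborel. exp_dens 1 x * (\<Sum>k. ennreal (g k x)) \<noteq> \<infinity>"
    by (intro nn_integral_PInf_AE) measurable
  then show ?thesis
  proof eventually_elim
    case (elim x)
    show ?case
    proof
      assume "0 \<le> x"
      then have "exp_dens 1 x \<noteq> 0"
        by (simp add: exp_dens_def exponential_density_def)
      then have "(\<Sum>k. ennreal (g k x)) \<noteq> \<top>"
        using elim by (auto simp: ennreal_mult_eq_top_iff)
      then show "summable (\<lambda>k. g k x)"
        using nonneg(1) by (intro summable_suminf_not_top) auto
    qed
  qed
qed

text \<open>Fatou's lemma twice, first over the data and then over the prior. For negative
  \<open>x\<close> all the densities vanish, so convergence on the half-line suffices.\<close>

lemma log_risk_le_liminf: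
  fixes s :: "nat \<Rightarrow> real \<Rightarrow> real"
  assumes [measurable_cong]: "sets F = sets borel"
    and [measurable]: "\<And>k. s k \<in> borel_measurable borel"
    and lim: "AE x in lborel. 0 \<le> x \<longrightarrow> (\<lambda>k. s k x) \<longlonglongrightarrow> t x"
  shows "log_risk t F \<le> liminf (\<lambda>k. log_risk (s k) F)"
proof -
  have inner: "(\<integral>\<^sup>+x. exp_dens m x * ennreal ((t x - ln m)\<^sup>2) \<partial>lborel)
      \<le> liminf (\<lambda>k. \<integral>\<^sup>+x. exp_dens m x * ennreal ((s k x - ln m)\<^sup>2) \<partial>lborel)" for m
  proof -
    have "(\<integral>\<^sup>+x. exp_dens m x * ennreal ((t x - ln m)\<^sup>2) \<partial>lborel)
      \<le> (\<integral>\<^sup>+x. liminf (\<lambda>k. exp_dens m x * ennreal ((s k x - ln m)\<^sup>2)) \<partial>lborel)"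
    proof (rule nn_integral_mono_AE, use lim in eventually_elim)
      case (elim x)
      show ?case
      proof (cases "0 \<le> x")
        case True
        then have "(\<lambda>k. exp_dens m x * ennreal ((s k x - ln m)\<^sup>2))
            \<longlonglongrightarrow> exp_dens m x * ennreal ((t x - ln m)\<^sup>2)"
          using elim by (intro ennreal_tendsto_cmult tendsto_ennrealI tendsto_intros)
            (auto simp: exp_dens_def)
        then show ?thesis
          by (simp add: lim_imp_Liminf)
      qed (simp add: exp_dens_def exponential_density_def)
    qed
    also have "\<dots> \<le> liminf (\<lambda>k. \<integral>\<^sup>+x. exp_dens m x * ennreal ((s k x - ln m)\<^sup>2) \<partial>lborel)"
      by (rule nn_integral_liminf) measurable
    finally show ?thesis .
  qed
  have "log_risk t F \<le> (\<integral>\<^sup>+m. liminf (\<lambda>k. \<integral>\<^sup>+x. exp_dens m x * ennreal ((s k x - ln m)\<^sup>2) \<partial>lborel) \<partial>F)"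
    unfolding log_risk_def by (intro nn_integral_mono inner)
  also have "\<dots> \<le> liminf (\<lambda>k. log_risk (s k) F)"
    unfolding log_risk_def by (rule nn_integral_liminf) measurable
  finally show ?thesis .
qed

text \<open>Pointwise, the right side minus the left side is the square of
  \<open>2 * s x - t x - u x\<close>.\<close>

lemma exp1_sq_dist_triangle:
  assumes [measurable]: "s \<in> borel_measurable borel" "t \<in> borel_measurable borel" "u \<in> borel_measurable borel"
    and "(\<integral>\<^sup>+x. exp_dens 1 x * ennreal ((s x - t x)\<^sup>2) \<partial>lborel) \<le> ennreal a"
    and "(\<integral>\<^sup>+x. exp_dens 1 x * ennreal ((s x - u x)\<^sup>2) \<partial>lborel) \<le> ennreal b"
    and "0 \<le> a" "0 \<le> b"
  shows "(\<integral>\<^sup>+x. exp_dens 1 x * ennreal ((u x - t x)\<^sup>2) \<partial>lborel) \<le> ennreal (2 * a + 2 * b)"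
proof -
  have "ennreal ((u x - t x)\<^sup>2) \<le> 2 * ennreal ((s x - t x)\<^sup>2) + 2 * ennreal ((s x - u x)\<^sup>2)" for x
  proof -
    have "2 * (s x - t x)\<^sup>2 + 2 * (s x - u x)\<^sup>2 - (u x - t x)\<^sup>2 = (2 * s x - t x - u x)\<^sup>2"
      by (simp add: power2_eq_square algebra_simps)
    then have "(u x - t x)\<^sup>2 \<le> 2 * (s x - t x)\<^sup>2 + 2 * (s x - u x)\<^sup>2"
      using zero_le_power2[of "2 * s x - t x - u x"] by linarith
    then have "ennreal ((u x - t x)\<^sup>2) \<le> ennreal (2 * (s x - t x)\<^sup>2 + 2 * (s x - u x)\<^sup>2)"
      by (rule ennreal_leI)
    then show ?thesis
      by (simp add: ennreal_mult)
  qed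
  then have "exp_dens 1 x * ennreal ((u x - t x)\<^sup>2)
      \<le> exp_dens 1 x * (2 * ennreal ((s x - t x)\<^sup>2) + 2 * ennreal ((s x - u x)\<^sup>2))" for x
    by (intro mult_left_mono) auto
  then have "(\<integral>\<^sup>+x. exp_dens 1 x * ennreal ((u x - t x)\<^sup>2) \<partial>lborel)
      \<le> (\<integral>\<^sup>+x. 2 * (exp_dens 1 x * ennreal ((s x - t x)\<^sup>2)) + 2 * (exp_dens 1 x * ennreal ((s x - u x)\<^sup>2)) \<partial>lborel)"
    by (intro nn_integral_mono) (simp add: distrib_left mult.left_commute)
  also have "\<dots> = 2 * (\<integral>\<^sup>+x. exp_dens 1 x * ennreal ((s x - t x)\<^sup>2) \<partial>lborel)
      + 2 * (\<integral>\<^sup>+x. exp_dens 1 x * ennreal ((s x - u x)\<^sup>2) \<partial>lborel)"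
    by (simp add: nn_integral_add nn_integral_cmult)
  also have "\<dots> \<le> 2 * ennreal a + 2 * ennreal b"
    by (intro add_mono mult_left_mono assms) auto
  also have "\<dots> = ennreal (2 * a + 2 * b)"
    using assms by (simp add: ennreal_mult)
  finally show ?thesis .
qed

section \<open>Construction of the minimax rule\<close>

text \<open>This makes the class nonempty, so that its supremum can be approximated by
  members.\<close>

lemma return_1_in_prior_class1: "0 < p \<Longrightarrow> return borel 1 \<in> prior_class1 p \<eta>"
  by (simp add: prior_class1_def prob_space_return AE_return nn_integral_return)

text \<open>Closeness is now measured in one fixed L2 space, so rules that belong to different
  priors can be compared.\<close>

lemma near_bayes_close_exp1:
  assumes p: "0 < p" "0 < \<eta>" and F: "F \<in> prior_class1 p \<eta>"
    and c: "c = exp (- (\<eta> * 2 powr (1 / p))) / 2"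
    and st: "s \<in> borel_measurable borel" "t \<in> borel_measurable borel"
    and nonneg: "0 \<le> V" "0 \<le> \<epsilon>" "0 \<le> e"
    and bnd: "ennreal V \<le> bayes_value F + ennreal \<epsilon>" "log_risk t F \<le> ennreal (V + \<epsilon>)"
      "log_risk s F \<le> ennreal (V + e)"
  shows "(\<integral>\<^sup>+x. exp_dens 1 x * ennreal ((s x - t x)\<^sup>2) \<partial>lborel) \<le> ennreal ((6 * \<epsilon> + 2 * e) / c)"
    (is "?N \<le> _")
proof -
  have c0: "0 < c" by (simp add: c)
  have "sets F = sets borel"
    using F by (simp add: prior_class1_def)
  then have "log_dist s t F \<le> ennreal (6 * \<epsilon> + 2 * e)"
    by (rule near_bayes_close) fact+
  then have "ennreal c * ?N \<le> ennreal (6 * \<epsilon> + 2 * e)"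
    using log_dist_ge_exp1[OF p F st] unfolding c by (rule order_trans[rotated])
  then have "ennreal (1 / c) * (ennreal c * ?N) \<le> ennreal (1 / c) * ennreal (6 * \<epsilon> + 2 * e)"
    by (rule mult_left_mono) simp
  then show ?thesis
    using c0 nonneg by (simp add: mult.assoc[symmetric] ennreal_mult[symmetric] del: ennreal_plus)
qed

lemma rho_bar_le_SUP_bayes_value:
  assumes p: "0 < p" "0 < \<eta>"
  shows "rho_bar p \<eta> \<le> (SUP F\<in>prior_class1 p \<eta>. bayes_value F)"
proof (cases "(SUP F\<in>prior_class1 p \<eta>. bayes_value F)")
  case (real V)
  let ?P = "prior_class1 p \<eta>"
  let ?N = "\<lambda>u. \<integral>\<^sup>+x. exp_dens 1 x * ennreal ((u x)\<^sup>2) \<partial>lborel"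
  define c where "c = exp (- (\<eta> * 2 powr (1 / p))) / 2"
  have c: "0 < c" by (simp add: c_def)
  \<comment> \<open>The rate 1/4 leaves room for two losses of order \<open>2 ^ k\<close>: the
    weights in the convergence proof for \<open>t k\<close>, and the division by \<open>l k\<close>
    at the end.\<close>
  define \<epsilon> :: "nat \<Rightarrow> real" where "\<epsilon> k = (1 / 4) ^ k" for k
  have \<epsilon>: "0 < \<epsilon> k" "\<epsilon> (Suc k) \<le> \<epsilon> k" for k
    by (simp_all add: \<epsilon>_def)
  have V: "0 \<le> V" "\<And>H. H \<in> ?P \<Longrightarrow> bayes_value H \<le> ennreal V"
    using real by (auto simp: real(2)[symmetric] intro: SUP_upper)
  have ne: "?P \<noteq> {}"
    using return_1_in_prior_class1[OF p(1)] by auto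
  have "\<exists>F t. F \<in> ?P \<and> t \<in> borel_measurable borel \<and> ennreal V \<le> bayes_value F + ennreal (\<epsilon> k)
      \<and> log_risk t F \<le> ennreal (V + \<epsilon> k)" for k
  proof -
    obtain F where F: "F \<in> ?P" "ennreal V \<le> bayes_value F + ennreal (\<epsilon> k)"
      using SUP_approx_ennreal[OF \<epsilon>(1) ne real(2)[symmetric], of k] by (auto intro: less_imp_le)
    have "bayes_value F < ennreal (V + \<epsilon> k)"
      using V(2)[OF F(1)] V(1) \<epsilon>(1)[of k] by (simp add: ennreal_lessI order.strict_trans1)
    then obtain t where "t \<in> borel_measurable borel" "log_risk t F < ennreal (V + \<epsilon> k)"
      unfolding bayes_value_def by (auto simp: INF_less_iff)
    then show ?thesis
      using F by (auto intro!: exI[of _ F] exI[of _ t])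
  qed
  then obtain F t where F: "\<And>k. F k \<in> ?P" and t [measurable]: "\<And>k. t k \<in> borel_measurable borel"
    and VF: "\<And>k. ennreal V \<le> bayes_value (F k) + ennreal (\<epsilon> k)"
    and tF: "\<And>k. log_risk (t k) (F k) \<le> ennreal (V + \<epsilon> k)"
    by metis
  \<comment> \<open>The slack \<open>\<epsilon>'\<close> may exceed \<open>\<epsilon> k\<close>, so
    that \<open>F (Suc k)\<close> can be treated with the tolerance of stage
    \<open>k\<close>.\<close>
  have close: "?N (\<lambda>x. s x - t k x) \<le> ennreal ((6 * \<epsilon>' + 2 * e) / c)"
    if "s \<in> borel_measurable borel" "0 \<le> e" "\<epsilon> k \<le> \<epsilon>'" "log_risk s (F k) \<le> ennreal (V + e)" for s k e \<epsilon>'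
  proof (rule near_bayes_close_exp1[OF p F c_def that(1) t V(1) _ that(2) _ _ that(4)])
    show "0 \<le> \<epsilon>'" using that(3) \<epsilon>(1)[of k] by linarith
    show "ennreal V \<le> bayes_value (F k) + ennreal \<epsilon>'"
      using VF[of k] that(3) by (meson add_left_mono ennreal_leI order_trans)
    show "log_risk (t k) (F k) \<le> ennreal (V + \<epsilon>')"
      using tF[of k] that(3) by (meson add_left_mono ennreal_leI order_trans)
  qed
  \<comment> \<open>The equal mixture of \<open>F k\<close> and \<open>F (Suc k)\<close> yields a
    rule with excess \<open>3 * \<epsilon> k\<close> at the former and
    \<open>4 * \<epsilon> k\<close> at the latter. Its distances to \<open>t k\<close> and
    \<open>t (Suc k)\<close> are then at most 12 and 14 times \<open>\<epsilon> k / c\<close>, and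
    52 is twice their sum.\<close>
  have step: "?N (\<lambda>x. t (Suc k) x - t k x) \<le> ennreal (52 * \<epsilon> k / c)" for k
  proof -
    have VS: "ennreal V \<le> bayes_value (F (Suc k)) + ennreal (\<epsilon> k)"
      using VF[of "Suc k"] \<epsilon>(2)[of k] by (meson add_left_mono ennreal_leI order_trans)
    obtain s where s: "s \<in> borel_measurable borel"
      "log_risk s (F (Suc k)) \<le> ennreal (V + 2 * \<epsilon> k / (1 / 2))"
      "log_risk s (F k) \<le> ennreal (V + (\<epsilon> k + 1 / 2 * \<epsilon> k) / (1 - 1 / 2))"
      by (rule mixture_near_minimax[of "F k" p \<eta> "F (Suc k)" V "\<epsilon> k" "\<epsilon> k" "1 / 2", OF F F V(2) V(1) \<epsilon>(1)
          less_imp_le[OF \<epsilon>(1)] _ _ VF VS]) auto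
    have "?N (\<lambda>x. s x - t k x) \<le> ennreal (12 * \<epsilon> k / c)"
      using close[OF s(1) _ order_refl, of "3 * \<epsilon> k" k] s(3) \<epsilon>(1)[of k] by simp
    moreover have "?N (\<lambda>x. s x - t (Suc k) x) \<le> ennreal (14 * \<epsilon> k / c)"
      using close[OF s(1) _ \<epsilon>(2), of "4 * \<epsilon> k" k] s(2) \<epsilon>(1)[of k] by simp
    ultimately have "?N (\<lambda>x. t (Suc k) x - t k x) \<le> ennreal (2 * (12 * \<epsilon> k / c) + 2 * (14 * \<epsilon> k / c))"
      using \<epsilon>(1)[of k] c by (intro exp1_sq_dist_triangle[OF s(1) t t]) auto
    then show ?thesis by simp
  qed
  have conv: "AE x in lborel. 0 \<le> x \<longrightarrow> convergent (\<lambda>k. t k x)"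
  proof -
    \<comment> \<open>Summable squares alone would not make the increments summable; the extra
      weight \<open>2 ^ k\<close> does, and it still leaves a geometric series.\<close>
    have "AE x in lborel. 0 \<le> x \<longrightarrow> summable (\<lambda>k. 2 ^ k * (t (Suc k) x - t k x)\<^sup>2)"
    proof (rule AE_summable_exp1[where a = "\<lambda>k. 52 / c * (1 / 2) ^ k"])
      fix k
      have "(\<integral>\<^sup>+x. exp_dens 1 x * ennreal (2 ^ k * (t (Suc k) x - t k x)\<^sup>2) \<partial>lborel)
        = ennreal (2 ^ k) * ?N (\<lambda>x. t (Suc k) x - t k x)"
        by (subst nn_integral_cmult[symmetric]) (auto simp: ennreal_mult mult.left_commute)
      also have "\<dots> \<le> ennreal (2 ^ k) * ennreal (52 * \<epsilon> k / c)"
        by (intro mult_left_mono step) simp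
      also have "\<dots> = ennreal (52 / c * (1 / 2) ^ k)"
      proof -
        have "(4::real) ^ k = 2 ^ k * 2 ^ k"
          by (simp flip: power_mult_distrib)
        then show ?thesis
          using c by (simp add: ennreal_mult[symmetric] \<epsilon>_def power_divide)
      qed
      finally show "(\<integral>\<^sup>+x. exp_dens 1 x * ennreal (2 ^ k * (t (Suc k) x - t k x)\<^sup>2) \<partial>lborel)
          \<le> ennreal (52 / c * (1 / 2) ^ k)" .
    qed (use c in \<open>auto intro!: summable_mult summable_geometric\<close>)
    then show ?thesis
    proof eventually_elim
      case (elim x)
      show ?case
      proof
        assume "0 \<le> x"
        define d where "d k = t (Suc k) x - t k x" for k
        have "summable (\<lambda>k. 2 ^ k * (d k)\<^sup>2 + (1 / 2) ^ k)"
          using elim \<open>0 \<le> x\<close> unfolding d_def by (intro summable_add summable_geometric) auto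
        \<comment> \<open>AM-GM\<close>
        moreover have "norm (d k) \<le> 2 ^ k * (d k)\<^sup>2 + (1 / 2) ^ k" for k
        proof -
          have "0 \<le> (2 ^ k * \<bar>d k\<bar> - 1)\<^sup>2" by simp
          then have "2 * (2 ^ k * \<bar>d k\<bar>) \<le> (2 ^ k)\<^sup>2 * (d k)\<^sup>2 + 1"
            by (simp add: power2_diff power_mult_distrib)
          then have "2 * \<bar>d k\<bar> \<le> 2 ^ k * (d k)\<^sup>2 + (1 / 2) ^ k"
            by (simp add: field_simps power2_eq_square)
          then show ?thesis by simp
        qed
        ultimately have "summable d"
          by (rule summable_comparison_test'[where N = 0])
        then have "convergent (\<lambda>n. \<Sum>k<n. d k)"
          by (simp add: summable_iff_convergent)
        then have "convergent (\<lambda>n. t n x - t 0 x)"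
          by (simp add: d_def sum_lessThan_telescope[where f = "\<lambda>k. t k x"])
        then show "convergent (\<lambda>k. t k x)"
          by (simp add: convergent_diff_const_right_iff)
      qed
    qed
  qed
  \<comment> \<open>Where the sequence diverges, \<open>lim\<close> is an unspecified value. The
    limit function is measurable all the same, and such points form a null set apart from the
    negative half-line, where the densities vanish.\<close>
  define \<tau> where "\<tau> x = lim (\<lambda>k. t k x)" for x
  have \<tau> [measurable]: "\<tau> \<in> borel_measurable borel"
    unfolding \<tau>_def by (rule borel_measurable_lim_metric) (rule t)
  have "log_risk \<tau> G \<le> ennreal V" if G: "G \<in> ?P" for G
  proof -
    \<comment> \<open>The weight of \<open>G\<close> tends to 0, yet slowly enough that
      \<open>2 * \<epsilon> k / l k = 4 * (1 / 2) ^ k\<close> vanishes too. As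
      \<open>1 - l k\<close> is at least 1/2, \<open>e k\<close> bounds the excess risk at
      \<open>F k\<close>; it is summable.\<close>
    define l :: "nat \<Rightarrow> real" where "l k = (1 / 2) ^ Suc k" for k
    define e where "e k = 2 * \<epsilon> k + 2 * l k * V" for k
    have l: "0 < l k" "l k < 1" "l k \<le> 1 / 2" for k
      using power_le_one[of "1 / 2 :: real" k] by (simp_all add: l_def)
    have "\<exists>s. s \<in> borel_measurable borel \<and> log_risk s G \<le> ennreal (V + 2 * \<epsilon> k / l k)
        \<and> log_risk s (F k) \<le> ennreal (V + e k)" for k
    proof -
      \<comment> \<open>Nothing is known about how close \<open>bayes_value G\<close> is to \<open>V\<close>; the weight \<open>l k\<close> absorbs this.\<close>
      have "ennreal V \<le> bayes_value G + ennreal V" by simp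
      then obtain s where s: "s \<in> borel_measurable borel" "log_risk s G \<le> ennreal (V + 2 * \<epsilon> k / l k)"
        "log_risk s (F k) \<le> ennreal (V + (\<epsilon> k + l k * V) / (1 - l k))"
        using mixture_near_minimax[OF F G V(2) V(1) \<epsilon>(1) V(1) l(1,2) VF, of k k] by auto
      have "(\<epsilon> k + l k * V) / (1 - l k) \<le> (\<epsilon> k + l k * V) / (1 / 2)"
        using V(1) \<epsilon>(1)[of k] l[of k] by (intro divide_left_mono) auto
      then have "V + (\<epsilon> k + l k * V) / (1 - l k) \<le> V + e k"
        by (simp add: e_def algebra_simps)
      then show ?thesis
        using s by (meson ennreal_leI order_trans)
    qed
    then obtain s where s [measurable]: "\<And>k. s k \<in> borel_measurable borel"
      and sG: "\<And>k. log_risk (s k) G \<le> ennreal (V + 2 * \<epsilon> k / l k)"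
      and sF: "\<And>k. log_risk (s k) (F k) \<le> ennreal (V + e k)"
      by metis
    have e0: "0 \<le> e k" for k
      using V(1) \<epsilon>(1)[of k] l[of k] by (simp add: e_def)
    have "summable \<epsilon>" "summable l"
      unfolding \<epsilon>_def l_def by (auto intro!: summable_geometric summable_mult)
    then have sum: "summable (\<lambda>k. (6 * \<epsilon> k + 2 * e k) / c)"
      unfolding e_def by (intro summable_divide summable_add summable_mult summable_mult2)
    \<comment> \<open>The rules \<open>s k\<close> depend on \<open>G\<close>, but their distance to
      \<open>t k\<close> tends to 0 almost everywhere, so their limit \<open>\<tau>\<close> does
      not.\<close>
    have "AE x in lborel. 0 \<le> x \<longrightarrow> summable (\<lambda>k. (s k x - t k x)\<^sup>2)"
    proof (rule AE_summable_exp1[OF _ _ _ _ sum])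
      show "?N (\<lambda>x. s k x - t k x) \<le> ennreal ((6 * \<epsilon> k + 2 * e k) / c)" for k
        by (rule close[OF s e0 order_refl sF])
      show "0 \<le> (6 * \<epsilon> k + 2 * e k) / c" for k
        using c \<epsilon>(1)[of k] e0[of k] by simp
    qed auto
    with conv have lim: "AE x in lborel. 0 \<le> x \<longrightarrow> (\<lambda>k. s k x) \<longlonglongrightarrow> \<tau> x"
    proof eventually_elim
      case (elim x)
      show ?case
      proof
        assume x: "0 \<le> x"
        have "(\<lambda>k. (s k x - t k x)\<^sup>2) \<longlonglongrightarrow> 0"
          using elim x by (intro summable_LIMSEQ_zero) simp
        then have "(\<lambda>k. s k x - t k x) \<longlonglongrightarrow> 0"
          by simp
        moreover have "(\<lambda>k. t k x) \<longlonglongrightarrow> \<tau> x"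
          using elim x by (auto simp: \<tau>_def convergent_LIMSEQ_iff)
        ultimately have "(\<lambda>k. s k x - t k x + t k x) \<longlonglongrightarrow> 0 + \<tau> x"
          by (rule tendsto_add)
        then show "(\<lambda>k. s k x) \<longlonglongrightarrow> \<tau> x" by simp
      qed
    qed
    have "sets G = sets borel"
      using G by (simp add: prior_class1_def)
    then have "log_risk \<tau> G \<le> liminf (\<lambda>k. log_risk (s k) G)"
      by (rule log_risk_le_liminf[OF _ s lim])
    also have "\<dots> \<le> liminf (\<lambda>k. ennreal (V + 2 * \<epsilon> k / l k))"
      by (intro Liminf_mono always_eventually allI sG)
    also have "\<dots> = ennreal V"
    proof (rule lim_imp_Liminf)
      have "2 * \<epsilon> k / l k = 4 * (1 / 2) ^ k" for k
      proof -
        have "(4::real) ^ k = 2 ^ k * 2 ^ k"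
          by (simp flip: power_mult_distrib)
        then show ?thesis by (simp add: \<epsilon>_def l_def power_divide)
      qed
      moreover have "(\<lambda>k. V + 4 * (1 / 2) ^ k) \<longlonglongrightarrow> V + 4 * 0"
        by (intro tendsto_intros LIMSEQ_power_zero) simp
      ultimately show "(\<lambda>k. ennreal (V + 2 * \<epsilon> k / l k)) \<longlonglongrightarrow> ennreal V"
        by (intro tendsto_ennrealI) simp
    qed simp
    finally show ?thesis .
  qed
  then have "(SUP G\<in>?P. log_risk \<tau> G) \<le> ennreal V"
    by (rule SUP_least)
  then show ?thesis
    unfolding rho_bar_eq_log_risk real(2) by (rule INF_lower2[OF \<tau>])
next
  case top
  then show ?thesis by (simp only: top_greatest)
qed

subsection \<open>The multivariate problem\<close>

lemma nn_integral_average: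
  fixes f :: "'i \<Rightarrow> 'a \<Rightarrow> real"
  assumes "\<And>i. i \<in> I \<Longrightarrow> f i \<in> borel_measurable M" "\<And>i x. 0 \<le> f i x"
  shows "(\<integral>\<^sup>+x. ennreal (1 / real n * (\<Sum>i\<in>I. f i x)) \<partial>M)
    = ennreal (1 / real n) * (\<Sum>i\<in>I. \<integral>\<^sup>+x. ennreal (f i x) \<partial>M)"
proof -
  have "ennreal (1 / real n * (\<Sum>i\<in>I. f i x)) = ennreal (1 / real n) * (\<Sum>i\<in>I. ennreal (f i x))" for x
    using assms by (subst ennreal_mult) (simp_all add: sum_nonneg)
  then show ?thesis
    using assms by (simp add: nn_integral_cmult nn_integral_sum del: sum_ennreal)
qed

lemma nn_integral_exp_dens: "0 < m \<Longrightarrow> (\<integral>\<^sup>+x. exp_dens m x \<partial>lborel) = 1"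
  using prob_space.emeasure_space_1[OF prob_space_exponential_density[of "1 / m"]]
  by (simp add: emeasure_density exp_dens_def)

lemma sets_exp_data [measurable_cong]: "sets (exp_data n \<mu>) = sets (\<Pi>\<^sub>M i\<in>{..<n}. (borel :: real measure))"
  unfolding exp_data_def by (rule sets_PiM_cong) auto

lemma nn_integral_exp_data_component:
  assumes \<mu>: "\<And>j. j < n \<Longrightarrow> 1 \<le> \<mu> j" and i: "i < n" and [measurable]: "f \<in> borel_measurable borel"
  shows "(\<integral>\<^sup>+x. f (x i) \<partial>exp_data n \<mu>) = (\<integral>\<^sup>+y. exp_dens (\<mu> i) y * f y \<partial>lborel)"
proof -
  let ?M = "\<lambda>i. density lborel (\<lambda>x. ennreal (exponential_density (1 / \<mu> i) x))"
  have ps: "prob_space (?M j)" if "j \<in> {..<n}" for j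
    using \<mu>[of j] that by (intro prob_space_exponential_density) auto
  have "(\<integral>\<^sup>+y. exp_dens (\<mu> i) y * f y \<partial>lborel) = (\<integral>\<^sup>+y. f y \<partial>?M i)"
    by (simp add: nn_integral_density exp_dens_def)
  also have "\<dots> = (\<integral>\<^sup>+y. f y \<partial>distr (Pi\<^sub>M {..<n} ?M) (?M i) (\<lambda>\<omega>. \<omega> i))"
    using distr_PiM_component[of "{..<n}" ?M i, OF ps] i by simp
  also have "\<dots> = (\<integral>\<^sup>+x. f (x i) \<partial>exp_data n \<mu>)"
    unfolding exp_data_def using i by (subst nn_integral_distr) auto
  finally show ?thesis ..
qed

section \<open>Upper bound: coordinatewise rules\<close>

text \<open>The loss in coordinate \<open>i\<close> involves only \<open>x i\<close>, so the other
  coordinates of the data integrate out, and each summand sees only a marginal of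
  \<open>\<pi>\<close>.\<close>

lemma bayes_risk_separable:
  assumes \<pi>: "\<pi> \<in> prior_class n p \<eta>" and [measurable]: "\<delta> \<in> borel_measurable borel"
  shows "bayes_risk n (\<lambda>x i. \<delta> (x i)) \<pi> =
    ennreal (1 / real n) * (\<Sum>i<n. \<integral>\<^sup>+\<mu>. \<integral>\<^sup>+y. exp_dens (\<mu> i) y * ennreal ((ln (\<delta> y) - ln (\<mu> i))\<^sup>2) \<partial>lborel \<partial>\<pi>)"
proof -
  have [measurable_cong]: "sets \<pi> = sets (\<Pi>\<^sub>M i\<in>{..<n}. (borel :: real measure))"
    and ae: "AE \<mu> in \<pi>. \<forall>i<n. 1 \<le> \<mu> i"
    using \<pi> by (simp_all add: prior_class_def)
  have "bayes_risk n (\<lambda>x i. \<delta> (x i)) \<pi> = (\<integral>\<^sup>+\<mu>. ennreal (1 / real n) *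
      (\<Sum>i<n. \<integral>\<^sup>+y. exp_dens (\<mu> i) y * ennreal ((ln (\<delta> y) - ln (\<mu> i))\<^sup>2) \<partial>lborel) \<partial>\<pi>)"
    unfolding bayes_risk_def
  proof (rule nn_integral_cong_AE, use ae in eventually_elim)
    case (elim \<mu>)
    have "(\<integral>\<^sup>+x. ennreal (1 / real n * (\<Sum>i<n. (ln (\<delta> (x i)) - ln (\<mu> i))\<^sup>2)) \<partial>exp_data n \<mu>)
      = ennreal (1 / real n) * (\<Sum>i<n. \<integral>\<^sup>+x. ennreal ((ln (\<delta> (x i)) - ln (\<mu> i))\<^sup>2) \<partial>exp_data n \<mu>)"
      by (rule nn_integral_average) auto
    also have "(\<Sum>i<n. \<integral>\<^sup>+x. ennreal ((ln (\<delta> (x i)) - ln (\<mu> i))\<^sup>2) \<partial>exp_data n \<mu>)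
      = (\<Sum>i<n. \<integral>\<^sup>+y. exp_dens (\<mu> i) y * ennreal ((ln (\<delta> y) - ln (\<mu> i))\<^sup>2) \<partial>lborel)"
    proof (rule sum.cong[OF refl])
      fix i assume "i \<in> {..<n}"
      then show "(\<integral>\<^sup>+x. ennreal ((ln (\<delta> (x i)) - ln (\<mu> i))\<^sup>2) \<partial>exp_data n \<mu>)
        = (\<integral>\<^sup>+y. exp_dens (\<mu> i) y * ennreal ((ln (\<delta> y) - ln (\<mu> i))\<^sup>2) \<partial>lborel)"
        using elim by (intro nn_integral_exp_data_component[where f = "\<lambda>y. ennreal ((ln (\<delta> y) - ln (\<mu> i))\<^sup>2)"]) auto
    qed
    finally show ?case .
  qed
  also have "\<dots> = ennreal (1 / real n) *
      (\<Sum>i<n. \<integral>\<^sup>+\<mu>. \<integral>\<^sup>+y. exp_dens (\<mu> i) y * ennreal ((ln (\<delta> y) - ln (\<mu> i))\<^sup>2) \<partial>lborel \<partial>\<pi>)"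
    by (subst nn_integral_cmult, measurable) (subst nn_integral_sum, auto)
  finally show ?thesis .
qed

text \<open>Drawing a coordinate uniformly at random turns averages over coordinates into integrals
  against \<open>G\<close>. Allowing every \<open>f\<close> lets the same \<open>G\<close> serve
  both the moment constraint and the risk.\<close>

lemma averaged_marginal:
  assumes \<pi>: "\<pi> \<in> prior_class n p \<eta>" and n: "1 \<le> n"
  obtains G where "G \<in> prior_class1 p \<eta>"
    "\<forall>f\<in>borel_measurable borel.
      (\<integral>\<^sup>+m. f m \<partial>G) = ennreal (1 / real n) * (\<Sum>i<n. \<integral>\<^sup>+\<mu>. f (\<mu> i) \<partial>\<pi>)"
proof
  have sets [measurable_cong]: "sets \<pi> = sets (\<Pi>\<^sub>M i\<in>{..<n}. (borel :: real measure))"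
    and ae: "AE \<mu> in \<pi>. \<forall>i<n. 1 \<le> \<mu> i"
    and ps: "prob_space \<pi>"
    and mom: "(\<integral>\<^sup>+\<mu>. ennreal (1 / real n * (\<Sum>i<n. ln (\<mu> i) powr p)) \<partial>\<pi>) \<le> ennreal (\<eta> powr p)"
    using \<pi> by (simp_all add: prior_class_def)
  \<comment> \<open>The family must consist of probability measures on
    \<open>[1, \<infinity>)\<close> for every index; the point mass at 1 is a default for indices
    without weight.\<close>
  define M where "M i = (if i < n then distr \<pi> borel (\<lambda>\<mu>. \<mu> i) else return borel (1::real))" for i
  have M: "\<And>i. prob_space (M i)" "\<And>i. sets (M i) = sets borel"
    using ps by (auto simp: M_def prob_space_return intro!: prob_space.prob_space_distr)
  let ?q = "pmf_of_set {..<n}"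
  let ?G = "measure_pmf ?q \<bind> M"
  note G = nn_integral_pmf_mixture[where q = ?q and M = M, OF M]
  have nz: "{..<n} \<noteq> {}" using n by (simp add: lessThan_empty_iff)
  have int: "(\<integral>\<^sup>+m. f m \<partial>?G) = ennreal (1 / real n) * (\<Sum>i<n. \<integral>\<^sup>+\<mu>. f (\<mu> i) \<partial>\<pi>)"
    if [measurable]: "f \<in> borel_measurable borel" for f
  proof -
    have "(\<integral>\<^sup>+m. f m \<partial>?G) = (\<Sum>i<n. \<integral>\<^sup>+m. f m \<partial>M i) / ennreal (real n)"
      using nz by (simp add: G(3)[OF that] nn_integral_pmf_of_set ennreal_of_nat_eq_real_of_nat)
    also have "(\<Sum>i<n. \<integral>\<^sup>+m. f m \<partial>M i) = (\<Sum>i<n. \<integral>\<^sup>+\<mu>. f (\<mu> i) \<partial>\<pi>)"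
      by (intro sum.cong) (auto simp: M_def nn_integral_distr)
    finally show ?thesis
      using n by (simp add: divide_ennreal_def inverse_ennreal inverse_eq_divide mult.commute)
  qed
  then show "\<forall>f\<in>borel_measurable borel.
      (\<integral>\<^sup>+m. f m \<partial>?G) = ennreal (1 / real n) * (\<Sum>i<n. \<integral>\<^sup>+\<mu>. f (\<mu> i) \<partial>\<pi>)" ..
  have "(\<integral>\<^sup>+m. ennreal (ln m powr p) \<partial>?G) = (\<integral>\<^sup>+\<mu>. ennreal (1 / real n * (\<Sum>i<n. ln (\<mu> i) powr p)) \<partial>\<pi>)"
    by (subst int, measurable) (subst nn_integral_average, auto)
  with mom have "(\<integral>\<^sup>+m. ennreal (ln m powr p) \<partial>?G) \<le> ennreal (\<eta> powr p)" by simp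
  moreover have "AE m in M i. 1 \<le> m" for i
  proof (cases "i < n")
    case True
    have "AE m in distr \<pi> borel (\<lambda>\<mu>. \<mu> i). 1 \<le> m"
      using ae True by (subst AE_distr_iff) auto
    then show ?thesis unfolding M_def using True by simp
  next
    case False
    have "AE m in return borel (1::real). 1 \<le> m"
      by (simp add: AE_return)
    then show ?thesis unfolding M_def using False by simp
  qed
  ultimately show "?G \<in> prior_class1 p \<eta>"
    using G(1,2) by (simp add: prior_class1_def G(4))
qed

lemma minimax_bayes_risk_le_rho_bar:
  assumes "1 \<le> n"
  shows "minimax_bayes_risk n p \<eta> \<le> rho_bar p \<eta>"
  unfolding rho_bar_def
proof (rule INF_greatest)
  fix \<delta> assume "\<delta> \<in> estimators1"
  then have \<delta> [measurable]: "\<delta> \<in> borel_measurable borel" and pos: "\<And>x. 0 < \<delta> x"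
    by (simp_all add: estimators1_def)
  have "(\<lambda>x i. \<delta> (x i)) \<in> estimators n"
    using pos by (simp add: estimators_def)
  then have "minimax_bayes_risk n p \<eta> \<le> (SUP \<pi>\<in>prior_class n p \<eta>. bayes_risk n (\<lambda>x i. \<delta> (x i)) \<pi>)"
    unfolding minimax_bayes_risk_def by (rule INF_lower)
  also have "\<dots> \<le> (SUP F\<in>prior_class1 p \<eta>. bayes_risk1 \<delta> F)"
  proof (rule SUP_least)
    fix \<pi> assume \<pi>: "\<pi> \<in> prior_class n p \<eta>"
    obtain G where G: "G \<in> prior_class1 p \<eta>"
      "\<forall>f\<in>borel_measurable borel.
        (\<integral>\<^sup>+m. f m \<partial>G) = ennreal (1 / real n) * (\<Sum>i<n. \<integral>\<^sup>+\<mu>. f (\<mu> i) \<partial>\<pi>)"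
      by (rule averaged_marginal[OF \<pi> assms])
    have "bayes_risk n (\<lambda>x i. \<delta> (x i)) \<pi> = bayes_risk1 \<delta> G"
      unfolding bayes_risk_separable[OF \<pi> \<delta>] bayes_risk1_eq_log_risk[OF \<delta>] log_risk_def
      by (rule G(2)[rule_format, symmetric]) measurable
    then show "bayes_risk n (\<lambda>x i. \<delta> (x i)) \<pi> \<le> (SUP F\<in>prior_class1 p \<eta>. bayes_risk1 \<delta> F)"
      using G(1) by (simp add: SUP_upper)
  qed
  finally show "minimax_bayes_risk n p \<eta> \<le> (SUP F\<in>prior_class1 p \<eta>. bayes_risk1 \<delta> F)" .
qed

section \<open>Lower bound: product priors\<close>

text \<open>This moves the dependence on \<open>\<mu>\<close> from the measure into the integrand,
  so that integrals over means and data can be interchanged. Both sides agree on boxes.\<close>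

lemma exp_data_eq_density:
  "exp_data n \<mu> = density (\<Pi>\<^sub>M i\<in>{..<n}. lborel) (\<lambda>x. \<Prod>i<n. exp_dens (\<mu> i) (x i))"
proof -
  interpret E: product_sigma_finite "\<lambda>i. density lborel (exp_dens (\<mu> i))"
    unfolding product_sigma_finite_def
    by (simp add: sigma_finite_measure.sigma_finite_iff_density_finite[OF sigma_finite_lborel] exp_dens_def)
  interpret L: product_sigma_finite "\<lambda>_::nat. lborel :: real measure" ..
  let ?P = "density (\<Pi>\<^sub>M i\<in>{..<n}. lborel) (\<lambda>x. \<Prod>i<n. exp_dens (\<mu> i) (x i))"
  have "?P = (\<Pi>\<^sub>M i\<in>{..<n}. density lborel (exp_dens (\<mu> i)))"
  proof (rule E.PiM_eqI)
    show "sets ?P = sets (\<Pi>\<^sub>M i\<in>{..<n}. density lborel (exp_dens (\<mu> i)))"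
      unfolding sets_density by (rule sets_PiM_cong) auto
    fix A :: "nat \<Rightarrow> real set"
    assume "\<And>i. i \<in> {..<n} \<Longrightarrow> A i \<in> sets (density lborel (exp_dens (\<mu> i)))"
    then have A [measurable]: "\<And>i. i \<in> {..<n} \<Longrightarrow> A i \<in> sets borel" by simp
    have "emeasure ?P (Pi\<^sub>E {..<n} A)
      = (\<integral>\<^sup>+x. (\<Prod>i<n. exp_dens (\<mu> i) (x i)) * indicator (Pi\<^sub>E {..<n} A) x \<partial>(\<Pi>\<^sub>M i\<in>{..<n}. lborel))"
      by (rule emeasure_density) (auto intro!: sets_PiM_I_finite A)
    also have "\<dots> = (\<integral>\<^sup>+x. (\<Prod>i<n. exp_dens (\<mu> i) (x i) * indicator (A i) (x i)) \<partial>(\<Pi>\<^sub>M i\<in>{..<n}. lborel))"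
    proof (rule nn_integral_cong)
      fix x :: "nat \<Rightarrow> real" assume "x \<in> space (\<Pi>\<^sub>M i\<in>{..<n}. lborel)"
      then have "indicator (Pi\<^sub>E {..<n} A) x = (\<Prod>i<n. indicator (A i) (x i) :: ennreal)"
        by (auto simp: space_PiM PiE_iff indicator_def prod_eq_1_iff split: if_splits intro!: prod_zero)
      then show "(\<Prod>i<n. exp_dens (\<mu> i) (x i)) * indicator (Pi\<^sub>E {..<n} A) x
        = (\<Prod>i<n. exp_dens (\<mu> i) (x i) * indicator (A i) (x i))"
        by (simp add: prod.distrib)
    qed
    also have "\<dots> = (\<Prod>i<n. \<integral>\<^sup>+y. exp_dens (\<mu> i) y * indicator (A i) y \<partial>lborel)"
      by (rule L.product_nn_integral_prod) auto
    also have "\<dots> = (\<Prod>i<n. emeasure (density lborel (exp_dens (\<mu> i))) (A i))"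
      by (intro prod.cong) (auto simp: emeasure_density)
    finally show "emeasure ?P (Pi\<^sub>E {..<n} A) = (\<Prod>i<n. emeasure (density lborel (exp_dens (\<mu> i))) (A i))" .
  qed simp
  then show ?thesis
    by (simp add: exp_data_def exp_dens_def[abs_def])
qed

text \<open>Fix the means and data of the coordinates in \<open>J\<close>. Then
  \<open>y \<mapsto> T (x(i := y))\<close> is a univariate rule, of risk at least
  \<open>bayes_value F\<close>, and the remaining variables carry total mass 1.\<close>

lemma bayes_value_le_coordinate_risk:
  fixes T :: "(nat \<Rightarrow> real) \<Rightarrow> real"
  assumes F: "prob_space F" "sets F = sets borel" "AE m in F. 1 \<le> m"
    and J: "finite J" "i \<notin> J"
    and T: "T \<in> borel_measurable (\<Pi>\<^sub>M j\<in>insert i J. borel)"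
  shows "bayes_value F \<le> (\<integral>\<^sup>+\<mu>. \<integral>\<^sup>+x. (\<Prod>j\<in>insert i J. exp_dens (\<mu> j) (x j)) * ennreal ((T x - ln (\<mu> i))\<^sup>2)
    \<partial>(\<Pi>\<^sub>M j\<in>insert i J. lborel) \<partial>(\<Pi>\<^sub>M j\<in>insert i J. F))"
proof -
  interpret F: prob_space F by fact
  interpret FP: product_prob_space "\<lambda>_::nat. F" ..
  interpret L: product_sigma_finite "\<lambda>_::nat. lborel :: real measure" ..
  interpret LJ: finite_product_sigma_finite "\<lambda>_::nat. lborel :: real measure" J
    by standard fact
  interpret LI: finite_product_sigma_finite "\<lambda>_::nat. lborel :: real measure" "insert i J"
    by standard (use J in simp)
  interpret P: pair_sigma_finite "\<Pi>\<^sub>M j\<in>J. (lborel :: real measure)" F ..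
  note F(2) [measurable_cong]
  have sT: "sets (\<Pi>\<^sub>M j\<in>insert i J. (lborel :: real measure)) = sets (\<Pi>\<^sub>M j\<in>insert i J. borel)"
    by (rule sets_PiM_cong) auto
  have T' [measurable]: "T \<in> borel_measurable (\<Pi>\<^sub>M j\<in>insert i J. lborel)"
    using T by (simp add: measurable_cong_sets[OF sT refl])
  let ?D = "\<lambda>\<mu> x. \<Prod>j\<in>J. exp_dens (\<mu> j) (x j)"
  have D: "(\<Prod>j\<in>insert i J. exp_dens ((\<mu>(i := m)) j) ((x(i := y)) j)) = exp_dens m y * ?D \<mu> x" for \<mu> m x y
  proof -
    have "(\<Prod>j\<in>J. exp_dens ((\<mu>(i := m)) j) ((x(i := y)) j)) = ?D \<mu> x"
      using J by (intro prod.cong) auto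
    then show ?thesis using J by simp
  qed
  have inner: "(\<integral>\<^sup>+x. (\<Prod>j\<in>insert i J. exp_dens ((\<mu>(i := m)) j) (x j)) * ennreal ((T x - ln m)\<^sup>2)
      \<partial>(\<Pi>\<^sub>M j\<in>insert i J. lborel))
    = (\<integral>\<^sup>+x. \<integral>\<^sup>+y. ?D \<mu> x * (exp_dens m y * ennreal ((T (x(i := y)) - ln m)\<^sup>2)) \<partial>lborel \<partial>(\<Pi>\<^sub>M j\<in>J. lborel))"
    for \<mu> m
    by (subst L.product_nn_integral_insert[OF J]) (measurable, simp only: D ac_simps)
  have sec [measurable]: "(\<lambda>y. T (x(i := y))) \<in> borel_measurable borel"
    if "x \<in> space (\<Pi>\<^sub>M j\<in>J. lborel)" for x
  proof -
    have "(\<lambda>y. x(i := y)) \<in> borel \<rightarrow>\<^sub>M (\<Pi>\<^sub>M j\<in>insert i J. lborel)"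
      using that by (intro measurable_fun_upd[where J = J]) auto
    then show ?thesis by (rule measurable_compose) (rule T')
  qed
  \<comment> \<open>Splitting off coordinate \<open>i\<close> leaves the order mean
    \<open>m\<close>, data in \<open>J\<close>, datum \<open>y\<close>. Exchanging the first two
    brings \<open>m\<close> next to \<open>y\<close>, which is the univariate risk.\<close>
  have swapped: "(\<integral>\<^sup>+m. \<integral>\<^sup>+x. (\<Prod>j\<in>insert i J. exp_dens ((\<mu>(i := m)) j) (x j)) * ennreal ((T x - ln m)\<^sup>2)
      \<partial>(\<Pi>\<^sub>M j\<in>insert i J. lborel) \<partial>F)
    = (\<integral>\<^sup>+x. ?D \<mu> x * log_risk (\<lambda>y. T (x(i := y))) F \<partial>(\<Pi>\<^sub>M j\<in>J. lborel))" for \<mu>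
  proof -
    have "(\<integral>\<^sup>+m. \<integral>\<^sup>+x. \<integral>\<^sup>+y. ?D \<mu> x * (exp_dens m y * ennreal ((T (x(i := y)) - ln m)\<^sup>2))
        \<partial>lborel \<partial>(\<Pi>\<^sub>M j\<in>J. lborel) \<partial>F)
      = (\<integral>\<^sup>+x. \<integral>\<^sup>+m. \<integral>\<^sup>+y. ?D \<mu> x * (exp_dens m y * ennreal ((T (x(i := y)) - ln m)\<^sup>2))
        \<partial>lborel \<partial>F \<partial>(\<Pi>\<^sub>M j\<in>J. lborel))"
      by (rule P.Fubini') measurable
    also have "\<dots> = (\<integral>\<^sup>+x. ?D \<mu> x * log_risk (\<lambda>y. T (x(i := y))) F \<partial>(\<Pi>\<^sub>M j\<in>J. lborel))"
      unfolding log_risk_def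
    proof (rule nn_integral_cong)
      fix x assume x: "x \<in> space (\<Pi>\<^sub>M j\<in>J. (lborel :: real measure))"
      note sec[OF x, measurable]
      show "(\<integral>\<^sup>+m. \<integral>\<^sup>+y. ?D \<mu> x * (exp_dens m y * ennreal ((T (x(i := y)) - ln m)\<^sup>2)) \<partial>lborel \<partial>F)
        = ?D \<mu> x * (\<integral>\<^sup>+m. \<integral>\<^sup>+y. exp_dens m y * ennreal ((T (x(i := y)) - ln m)\<^sup>2) \<partial>lborel \<partial>F)"
        by (simp add: nn_integral_cmult)
    qed
    finally show ?thesis by (simp only: inner)
  qed
  \<comment> \<open>The densities are normalized only for positive means, hence a statement for
    almost every \<open>\<mu>\<close>.\<close>
  have mass: "AE \<mu> in (\<Pi>\<^sub>M j\<in>J. F). (\<integral>\<^sup>+x. ?D \<mu> x \<partial>(\<Pi>\<^sub>M j\<in>J. lborel)) = 1"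
  proof -
    have "AE \<mu> in (\<Pi>\<^sub>M j\<in>J. F). \<forall>j\<in>J. 1 \<le> \<mu> j"
      using J by (intro AE_ball_countable[THEN iffD2] ballI AE_PiM_component F) (auto intro: countable_finite)
    then show ?thesis
    proof eventually_elim
      case (elim \<mu>)
      have "(\<integral>\<^sup>+x. ?D \<mu> x \<partial>(\<Pi>\<^sub>M j\<in>J. lborel)) = (\<Prod>j\<in>J. \<integral>\<^sup>+y. exp_dens (\<mu> j) y \<partial>lborel)"
        by (rule L.product_nn_integral_prod) (use J in auto)
      also have "\<dots> = 1"
        using elim by (intro prod.neutral) (auto intro!: nn_integral_exp_dens)
      finally show ?case .
    qed
  qed
  have "bayes_value F = (\<integral>\<^sup>+\<mu>. bayes_value F \<partial>(\<Pi>\<^sub>M j\<in>J. F))"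
    using prob_space.emeasure_space_1[OF prob_space_PiM[of J "\<lambda>_. F", OF F(1)]] by simp
  also have "\<dots> \<le> (\<integral>\<^sup>+\<mu>. \<integral>\<^sup>+x. ?D \<mu> x * log_risk (\<lambda>y. T (x(i := y))) F \<partial>(\<Pi>\<^sub>M j\<in>J. lborel) \<partial>(\<Pi>\<^sub>M j\<in>J. F))"
  proof (rule nn_integral_mono_AE, use mass in eventually_elim)
    case (elim \<mu>)
    have "bayes_value F = (\<integral>\<^sup>+x. ?D \<mu> x * bayes_value F \<partial>(\<Pi>\<^sub>M j\<in>J. lborel))"
      using elim by (simp add: nn_integral_multc)
    also have "\<dots> \<le> (\<integral>\<^sup>+x. ?D \<mu> x * log_risk (\<lambda>y. T (x(i := y))) F \<partial>(\<Pi>\<^sub>M j\<in>J. lborel))"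
      by (intro nn_integral_mono mult_left_mono bayes_value_le sec) auto
    finally show ?case .
  qed
  also have "\<dots> = (\<integral>\<^sup>+\<mu>. \<integral>\<^sup>+m. \<integral>\<^sup>+x. (\<Prod>j\<in>insert i J. exp_dens ((\<mu>(i := m)) j) (x j)) * ennreal ((T x - ln ((\<mu>(i := m)) i))\<^sup>2)
      \<partial>(\<Pi>\<^sub>M j\<in>insert i J. lborel) \<partial>F \<partial>(\<Pi>\<^sub>M j\<in>J. F))"
    by (simp only: swapped fun_upd_same)
  also have "\<dots> = (\<integral>\<^sup>+\<mu>. \<integral>\<^sup>+x. (\<Prod>j\<in>insert i J. exp_dens (\<mu> j) (x j)) * ennreal ((T x - ln (\<mu> i))\<^sup>2)
    \<partial>(\<Pi>\<^sub>M j\<in>insert i J. lborel) \<partial>(\<Pi>\<^sub>M j\<in>insert i J. F))"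
    by (rule FP.product_nn_integral_insert[OF J, symmetric]) measurable
  finally show ?thesis .
qed

lemma product_prior_in_prior_class:
  assumes F: "F \<in> prior_class1 p \<eta>" and n: "1 \<le> n"
  shows "(\<Pi>\<^sub>M i\<in>{..<n}. F) \<in> prior_class n p \<eta>"
proof -
  have Fp: "prob_space F" "AE m in F. 1 \<le> m"
    and [measurable_cong]: "sets F = sets borel"
    and mom: "(\<integral>\<^sup>+m. ennreal (ln m powr p) \<partial>F) \<le> ennreal (\<eta> powr p)"
    using F by (simp_all add: prior_class1_def)
  let ?P = "\<Pi>\<^sub>M i\<in>{..<n}. F"
  have comp: "(\<integral>\<^sup>+\<mu>. ennreal (ln (\<mu> i) powr p) \<partial>?P) = (\<integral>\<^sup>+m. ennreal (ln m powr p) \<partial>F)" if "i < n" for i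
  proof -
    have "(\<integral>\<^sup>+m. ennreal (ln m powr p) \<partial>F) = (\<integral>\<^sup>+m. ennreal (ln m powr p) \<partial>distr ?P F (\<lambda>\<omega>. \<omega> i))"
      using distr_PiM_component[of "{..<n}" "\<lambda>_. F" i] Fp that by simp
    also have "\<dots> = (\<integral>\<^sup>+\<mu>. ennreal (ln (\<mu> i) powr p) \<partial>?P)"
      using that by (subst nn_integral_distr) auto
    finally show ?thesis ..
  qed
  have "(\<integral>\<^sup>+\<mu>. ennreal (1 / real n * (\<Sum>i<n. ln (\<mu> i) powr p)) \<partial>?P)
    = ennreal (1 / real n) * (\<Sum>i<n. \<integral>\<^sup>+\<mu>. ennreal (ln (\<mu> i) powr p) \<partial>?P)"
    by (rule nn_integral_average) auto
  also have "\<dots> = ennreal (1 / real n) * ennreal (real n) * (\<integral>\<^sup>+m. ennreal (ln m powr p) \<partial>F)"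
    by (simp add: comp ennreal_of_nat_eq_real_of_nat mult.assoc)
  also have "\<dots> = (\<integral>\<^sup>+m. ennreal (ln m powr p) \<partial>F)"
    using n by (simp flip: ennreal_mult)
  also note mom
  finally have "(\<integral>\<^sup>+\<mu>. ennreal (1 / real n * (\<Sum>i<n. ln (\<mu> i) powr p)) \<partial>?P) \<le> ennreal (\<eta> powr p)" .
  moreover have "AE \<mu> in ?P. \<forall>i\<in>{..<n}. 1 \<le> \<mu> i"
    by (intro AE_ball_countable[THEN iffD2] ballI AE_PiM_component Fp) auto
  then have "AE \<mu> in ?P. \<forall>i<n. 1 \<le> \<mu> i" by eventually_elim simp
  moreover have "sets ?P = sets (\<Pi>\<^sub>M i\<in>{..<n}. borel)"
    by (rule sets_PiM_cong) (auto simp: \<open>sets F = sets borel\<close>)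
  ultimately show ?thesis
    using prob_space_PiM[of "{..<n}" "\<lambda>_. F", OF Fp(1)] by (simp add: prior_class_def)
qed

text \<open>Each coordinate of \<open>\<delta>\<close> may use all the data, but under independent
  means the other observations act only as external randomization. Averaging the coordinate bounds
  gives the claim.\<close>

lemma bayes_value_le_product_risk:
  assumes F: "F \<in> prior_class1 p \<eta>" and n: "1 \<le> n" and \<delta>: "\<delta> \<in> estimators n"
  shows "bayes_value F \<le> bayes_risk n \<delta> (\<Pi>\<^sub>M i\<in>{..<n}. F)"
proof -
  have Fp: "prob_space F" "sets F = sets borel" "AE m in F. 1 \<le> m"
    using F by (simp_all add: prior_class1_def)
  note Fp(2) [measurable_cong]
  let ?B = "\<Pi>\<^sub>M i\<in>{..<n}. (borel :: real measure)" and ?L = "\<Pi>\<^sub>M i\<in>{..<n}. (lborel :: real measure)"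
  let ?P = "\<Pi>\<^sub>M i\<in>{..<n}. F"
  let ?D = "\<lambda>\<mu> x. \<Prod>i<n. exp_dens (\<mu> i) (x i)"
  interpret L: product_sigma_finite "\<lambda>_::nat. lborel :: real measure" ..
  interpret Ln: finite_product_sigma_finite "\<lambda>_::nat. lborel :: real measure" "{..<n}"
    by standard simp
  have sL [measurable_cong]: "sets ?L = sets ?B"
    by (rule sets_PiM_cong) auto
  have \<delta>m [measurable]: "(\<lambda>x. \<delta> x i) \<in> borel_measurable ?B" if "i \<in> {..<n}" for i
    using \<delta> that by (simp add: estimators_def)
  have inner: "(\<integral>\<^sup>+x. ennreal (1 / real n * (\<Sum>i<n. (ln (\<delta> x i) - ln (\<mu> i))\<^sup>2)) \<partial>exp_data n \<mu>)
    = ennreal (1 / real n) * (\<Sum>i<n. \<integral>\<^sup>+x. ?D \<mu> x * ennreal ((ln (\<delta> x i) - ln (\<mu> i))\<^sup>2) \<partial>?L)" for \<mu>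
  proof -
    have "(\<integral>\<^sup>+x. ennreal (1 / real n * (\<Sum>i<n. (ln (\<delta> x i) - ln (\<mu> i))\<^sup>2)) \<partial>exp_data n \<mu>)
      = ennreal (1 / real n) * (\<Sum>i<n. \<integral>\<^sup>+x. ennreal ((ln (\<delta> x i) - ln (\<mu> i))\<^sup>2) \<partial>exp_data n \<mu>)"
      by (rule nn_integral_average) auto
    also have "(\<Sum>i<n. \<integral>\<^sup>+x. ennreal ((ln (\<delta> x i) - ln (\<mu> i))\<^sup>2) \<partial>exp_data n \<mu>)
      = (\<Sum>i<n. \<integral>\<^sup>+x. ?D \<mu> x * ennreal ((ln (\<delta> x i) - ln (\<mu> i))\<^sup>2) \<partial>?L)"
      unfolding exp_data_eq_density by (intro sum.cong refl nn_integral_density) auto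
    finally show ?thesis .
  qed
  have coord: "bayes_value F \<le> (\<integral>\<^sup>+\<mu>. \<integral>\<^sup>+x. ?D \<mu> x * ennreal ((ln (\<delta> x i) - ln (\<mu> i))\<^sup>2) \<partial>?L \<partial>?P)"
    if i: "i \<in> {..<n}" for i
  proof -
    have I: "{..<n} = insert i ({..<n} - {i})" using i by auto
    have "(\<lambda>x. ln (\<delta> x i)) \<in> borel_measurable ?B"
      using i by measurable
    then show ?thesis
      using bayes_value_le_coordinate_risk[OF Fp, of "{..<n} - {i}" i "\<lambda>x. ln (\<delta> x i)"]
      unfolding I[symmetric] by simp
  qed
  have "bayes_value F = ennreal (1 / real n) * ennreal (real n) * bayes_value F"
    using n by (simp flip: ennreal_mult)
  also have "\<dots> = ennreal (1 / real n) * (\<Sum>i<n. bayes_value F)"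
    by (simp add: ennreal_of_nat_eq_real_of_nat mult.assoc)
  also have "\<dots> \<le> ennreal (1 / real n)
      * (\<Sum>i<n. \<integral>\<^sup>+\<mu>. \<integral>\<^sup>+x. ?D \<mu> x * ennreal ((ln (\<delta> x i) - ln (\<mu> i))\<^sup>2) \<partial>?L \<partial>?P)"
    by (intro mult_left_mono sum_mono coord) auto
  also have "\<dots> = bayes_risk n \<delta> ?P"
    unfolding bayes_risk_def inner
    by (subst nn_integral_cmult, measurable) (subst nn_integral_sum, auto)
  finally show ?thesis .
qed

lemma SUP_bayes_value_le_minimax_bayes_risk:
  assumes "1 \<le> n"
  shows "(SUP F\<in>prior_class1 p \<eta>. bayes_value F) \<le> minimax_bayes_risk n p \<eta>"
  unfolding minimax_bayes_risk_def
proof (intro INF_greatest SUP_least)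
  fix \<delta> F assume "\<delta> \<in> estimators n" "F \<in> prior_class1 p \<eta>"
  then show "bayes_value F \<le> (SUP \<pi>\<in>prior_class n p \<eta>. bayes_risk n \<delta> \<pi>)"
    using assms by (intro SUP_upper2[where i = "\<Pi>\<^sub>M i\<in>{..<n}. F"]
        product_prior_in_prior_class bayes_value_le_product_risk)
qed

theorem theorem2p2:
  fixes p \<eta> :: real and n :: nat
  assumes "0 < p" and "p < 2" and "0 < \<eta>" and "1 \<le> n"
  shows "minimax_bayes_risk n p \<eta> = rho_bar p \<eta>"
proof (rule antisym)
  show "minimax_bayes_risk n p \<eta> \<le> rho_bar p \<eta>"
    by (rule minimax_bayes_risk_le_rho_bar) fact
  \<comment> \<open>The maximin value, the supremum of \<open>bayes_value\<close> over the
    univariate priors, lies between the two sides.\<close>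
  show "rho_bar p \<eta> \<le> minimax_bayes_risk n p \<eta>"
    using rho_bar_le_SUP_bayes_value SUP_bayes_value_le_minimax_bayes_risk assms
    by (meson order_trans)
qed

end
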